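(* Let $\mathcal{H}_A,\mathcal{H}_B$ be finite-dimensional Hilbert spaces with $d_A=\dim\mathcal{H}_A$, let $(|k\rangle)_k$ be an orthonormal basis of $\mathcal{H}_B$, and let $$\rho^{AB}=\sum_k p_k\,\rho_k^A\otimes|k\rangle\langle k|^B,\qquad \sigma^{AB}=\sum_k q_k\,\sigma_k^A\otimes|k\rangle\langle k|^B,$$ where $(p_k)$ and $(q_k)$ are probability distributions and $\rho_k^A,\sigma_k^A$ are states on $\mathcal{H}_A$. If $\|\rho^{AB}-\sigma^{AB}\|_1\le\epsilon$, then $$\bigl|S(A|B)_\rho-S(A|B)_\sigma\bigr|\le\eta(2\epsilon)+3\epsilon\log d_A.$$
   Context: $\|\cdot\|_1$ is the trace norm, $S(\rho)=-\operatorname{Tr}\rho\log\rho$ is the von Neumann entropy, and $\log$ is to base 2. For a state $\rho^{AB}$ with reduced state $\rho^B=\operatorname{Tr}_A\rho^{AB}$, the conditional von Neumann entropy is $S(A|B)_\rho=S(\rho^{AB})-S(\rho^B)$. The function $\eta:[0,\infty)\to\mathbb{R}$ is defined by $\eta(\epsilon)=-\epsilon\log\epsilon$ for $\epsilon\le\frac14$ (with $\eta(0)=0$) and $\eta(\epsilon)=\frac12$ otherwise. *)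

theory Defs
  imports "HOL-Analysis.Analysis"
begin

text \<open>A Hilbert space of finite dimension is \<open>complex^'n\<close> with \<open>CARD('n)\<close> its dimension; operators
  on it are square matrices. The tensor product of \<open>complex^'a\<close> and \<open>complex^'b\<close> is
  \<open>complex^('a \<times> 'b)\<close>, with basis vector \<open>(i, j)\<close> standing for the tensor product of the
  \<open>i\<close>-th and \<open>j\<close>-th standard basis vectors.\<close>

text \<open>The library's \<open>\<bullet>\<close> on \<open>complex^'n\<close> is only the real part of the Hermitian inner product.\<close>

definition cinner :: "complex^'n \<Rightarrow> complex^'n \<Rightarrow> complex" where
  "cinner v w = (\<Sum>i\<in>UNIV. cnj (v $ i) * w $ i)"

text \<open>A family indexed by \<open>'n\<close> itself has as many members as the dimension of the space, so
  orthonormality alone makes it a basis.\<close>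

definition orthonormal_basis :: "('n \<Rightarrow> complex^'n) \<Rightarrow> bool" where
  "orthonormal_basis e \<longleftrightarrow> (\<forall>i j. cinner (e i) (e j) = (if i = j then 1 else 0))"

definition adjoint_mat :: "complex^'n^'m \<Rightarrow> complex^'m^'n" where
  "adjoint_mat A = (\<chi> i j. cnj (A $ j $ i))"

definition unitary_mat :: "complex^'n^'n \<Rightarrow> bool" where
  "unitary_mat U \<longleftrightarrow> U ** adjoint_mat U = mat 1 \<and> adjoint_mat U ** U = mat 1"

definition positive_op :: "complex^'n^'n \<Rightarrow> bool" where
  "positive_op A \<longleftrightarrow> adjoint_mat A = A \<and> (\<forall>v. cinner v (A *v v) \<in> \<real>\<^sub>\<ge>\<^sub>0)"

definition state :: "complex^'n^'n \<Rightarrow> bool" where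
  "state R \<longleftrightarrow> positive_op R \<and> trace R = 1"

definition prob_distribution :: "('n::finite \<Rightarrow> real) \<Rightarrow> bool" where
  "prob_distribution p \<longleftrightarrow> (\<forall>k. 0 \<le> p k) \<and> (\<Sum>k\<in>UNIV. p k) = 1"

definition ket_bra :: "complex^'n \<Rightarrow> complex^'m \<Rightarrow> complex^'m^'n" where
  "ket_bra v w = (\<chi> i j. v $ i * cnj (w $ j))"

definition tensor_op :: "complex^'a^'a \<Rightarrow> complex^'b^'b \<Rightarrow> complex^('a \<times> 'b)^('a \<times> 'b)"
    (infixr "\<otimes>\<^sub>o\<^sub>p" 75) where
  "A \<otimes>\<^sub>o\<^sub>p B = (\<chi> i j. A $ fst i $ fst j * B $ snd i $ snd j)"

definition partial_trace_fst :: "complex^('a::finite \<times> 'b)^('a \<times> 'b) \<Rightarrow> complex^'b^'b" where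
  "partial_trace_fst R = (\<chi> i j. \<Sum>k\<in>UNIV. R $ (k, i) $ (k, j))"

definition diag_mat :: "('n \<Rightarrow> real) \<Rightarrow> complex^'n^'n" where
  "diag_mat d = (\<chi> i j. if i = j then complex_of_real (d i) else 0)"

text \<open>Functional calculus for Hermitian matrices. The value does not depend on the chosen
  diagonalization, see \<open>fun_op_unitary_diag\<close> below.\<close>

definition fun_op :: "(real \<Rightarrow> real) \<Rightarrow> complex^'n^'n \<Rightarrow> complex^'n^'n" where
  "fun_op f A = (THE B. \<exists>U d. unitary_mat U \<and> A = U ** diag_mat d ** adjoint_mat U \<and>
     B = U ** diag_mat (\<lambda>i. f (d i)) ** adjoint_mat U)"

definition trace_norm :: "complex^'n^'n \<Rightarrow> real" where
  "trace_norm A = Re (trace (fun_op sqrt (adjoint_mat A ** A)))"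

text \<open>The usual convention that \<open>0 log 0 = 0\<close> is built in, as \<open>log 2 0 = 0\<close>.\<close>

definition vn_entropy :: "complex^'n^'n \<Rightarrow> real" where
  "vn_entropy R = - Re (trace (R ** fun_op (log 2) R))"

definition cond_entropy :: "complex^('a \<times> 'b)^('a::finite \<times> 'b::finite) \<Rightarrow> real" where
  "cond_entropy R = vn_entropy R - vn_entropy (partial_trace_fst R)"

text \<open>Only used for nonnegative arguments; at \<open>0\<close> the first branch gives \<open>0\<close>.\<close>

definition eta :: "real \<Rightarrow> real" where
  "eta x = (if x \<le> 1/4 then - x * log 2 x else 1/2)"

lemma fun_op_unitary_diag:
  fixes U :: "complex^'n^'n"
  assumes U: "unitary_mat U"
  shows "fun_op f (U ** diag_mat d ** adjoint_mat U)
    = U ** diag_mat (\<lambda>i. f (d i)) ** adjoint_mat U"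
proof -
  have uniq: "U ** diag_mat (\<lambda>i. f (d i)) ** adjoint_mat U
      = V ** diag_mat (\<lambda>i. f (e i)) ** adjoint_mat V"
    if V: "unitary_mat V"
      and eq: "U ** diag_mat d ** adjoint_mat U = V ** diag_mat e ** adjoint_mat V"
    for V :: "complex^'n^'n" and e
  proof -
    define W where "W = adjoint_mat V ** U"
    have entry1: "(W ** diag_mat g) $ i $ j = W $ i $ j * complex_of_real (g j)" for g i j
    proof -
      have "(W ** diag_mat g) $ i $ j
          = (\<Sum>k\<in>UNIV. if k = j then W $ i $ k * complex_of_real (g k) else 0)"
        unfolding matrix_matrix_mult_def diag_mat_def vec_lambda_beta
        by (rule sum.cong) auto
      then show ?thesis by simp
    qed
    have entry2: "(diag_mat g ** W) $ i $ j = complex_of_real (g i) * W $ i $ j" for g i j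
    proof -
      have "(diag_mat g ** W) $ i $ j
          = (\<Sum>k\<in>UNIV. if i = k then complex_of_real (g k) * W $ k $ j else 0)"
        unfolding matrix_matrix_mult_def diag_mat_def vec_lambda_beta
        by (rule sum.cong) auto
      then show ?thesis by simp
    qed
    have UU: "adjoint_mat U ** U = mat 1" "U ** adjoint_mat U = mat 1"
      and VV: "adjoint_mat V ** V = mat 1" "V ** adjoint_mat V = mat 1"
      using U V by (auto simp: unitary_mat_def)
    have "W ** diag_mat d = adjoint_mat V ** (U ** diag_mat d ** adjoint_mat U) ** U"
      by (metis W_def UU(1) matrix_mul_assoc matrix_mul_rid)
    also have "\<dots> = diag_mat e ** W"
      unfolding eq by (metis W_def VV(1) matrix_mul_assoc matrix_mul_lid)
    finally have "W $ i $ j * complex_of_real (d j) = complex_of_real (e i) * W $ i $ j" for i j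
      unfolding entry1 [symmetric] entry2 [symmetric] by simp
    then have "W $ i $ j = 0 \<or> d j = e i" for i j
      by (metis mult.commute mult_left_cancel of_real_eq_iff)
    then have entry_f:
      "W $ i $ j * complex_of_real (f (d j)) = complex_of_real (f (e i)) * W $ i $ j" for i j
      by (metis mult.commute mult_zero_left)
    have W: "W ** diag_mat (\<lambda>i. f (d i)) = diag_mat (\<lambda>i. f (e i)) ** W"
      by (simp add: vec_eq_iff entry1 entry2 entry_f)
    have "U ** diag_mat (\<lambda>i. f (d i)) ** adjoint_mat U
        = V ** (W ** diag_mat (\<lambda>i. f (d i))) ** adjoint_mat U"
      by (metis W_def VV(2) matrix_mul_assoc matrix_mul_lid)
    also have "\<dots> = V ** diag_mat (\<lambda>i. f (e i)) ** adjoint_mat V"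
      unfolding W by (metis W_def UU(2) matrix_mul_assoc matrix_mul_rid)
    finally show ?thesis .
  qed
  show ?thesis
    unfolding fun_op_def
  proof (rule the_equality)
    show "\<exists>V e. unitary_mat V \<and>
        U ** diag_mat d ** adjoint_mat U = V ** diag_mat e ** adjoint_mat V \<and>
        U ** diag_mat (\<lambda>i. f (d i)) ** adjoint_mat U
          = V ** diag_mat (\<lambda>i. f (e i)) ** adjoint_mat V"
      by (rule exI [of _ U], rule exI [of _ d]) (simp add: U)
  next
    fix B
    assume "\<exists>V e. unitary_mat V \<and>
        U ** diag_mat d ** adjoint_mat U = V ** diag_mat e ** adjoint_mat V \<and>
        B = V ** diag_mat (\<lambda>i. f (e i)) ** adjoint_mat V"
    then obtain V e where "unitary_mat V"
      and "U ** diag_mat d ** adjoint_mat U = V ** diag_mat e ** adjoint_mat V"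
      and B: "B = V ** diag_mat (\<lambda>i. f (e i)) ** adjoint_mat V"
      by (elim exE conjE)
    then show "B = U ** diag_mat (\<lambda>i. f (d i)) ** adjoint_mat U"
      unfolding B by (intro uniq [symmetric])
  qed
qed

end

theory Submission
  imports Defs
begin

text \<open>Both conditional entropies are of the form \<open>S(A|B) = \<Sum> ent (p\<^sub>k r\<^sub>k\<^sub>j) - \<Sum> ent (p\<^sub>k)\<close> with
  \<open>ent x = - x log x\<close> and \<open>r\<^sub>k\<^sub>j\<close> the eigenvalues of \<open>\<rho>\<^sub>k\<close>. Replacing \<open>\<rho>\<^sup>A\<^sup>B\<close> by its diagonal in a product
  eigenbasis of \<open>\<sigma>\<^sup>A\<^sup>B\<close> can only increase \<open>S(A|B)\<^sub>\<rho>\<close>, leaves the marginal on \<open>B\<close> unchanged and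
  contracts the trace distance, so the claim reduces to two classical joint distributions \<open>x\<close>, \<open>y\<close>.
  For these, the conditional entropy \<open>F\<close> is superadditive by the log-sum inequality. With
  \<open>t = (x - y)\<^sup>+\<close>, \<open>n = (y - x)\<^sup>+\<close> and \<open>T = \<Sum> t \<le> \<epsilon>/2\<close> one has \<open>x + n = y + t\<close>, hence
  \<open>F x \<le> F (y + t) \<le> F y + T log d\<^sub>A + ent T - ent (1 + T)\<close>, which implies the
  stated bound unless \<open>d\<^sub>A = 1\<close>, in which case \<open>F = 0\<close>.\<close>

section \<open>Classical entropy inequalities\<close>

definition ent :: "real \<Rightarrow> real" where
  "ent x = - x * log 2 x"

text \<open>The tangent bound \<open>ln z \<le> z - 1\<close> at
  \<open>z = b i * A / (a i * B)\<close>, weighted by \<open>a i\<close>, leaves corrections that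
  sum to zero. Assumption \<open>ab\<close> excludes terms whose true value is minus infinity but
  which \<open>log 2 0 = 0\<close> would turn into \<open>0\<close>.\<close>

lemma log_sum_inequality:
  fixes a b :: "'i \<Rightarrow> real"
  assumes "finite I" and a: "\<And>i. i \<in> I \<Longrightarrow> 0 \<le> a i" and b: "\<And>i. i \<in> I \<Longrightarrow> 0 \<le> b i"
    and ab: "\<And>i. i \<in> I \<Longrightarrow> b i = 0 \<Longrightarrow> a i = 0"
  shows "(\<Sum>i\<in>I. a i * log 2 (b i / a i)) \<le> sum a I * log 2 (sum b I / sum a I)"
proof (cases "sum a I = 0")
  case True
  then have "\<And>i. i \<in> I \<Longrightarrow> a i = 0"
    using a \<open>finite I\<close> by (simp add: sum_nonneg_eq_0_iff)
  then show ?thesis by simp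
next
  case False
  define A B where "A = sum a I" and "B = sum b I"
  have A: "A > 0" using False a sum_nonneg[of I a] by (simp add: A_def)
  have "B \<noteq> 0"
  proof
    assume "B = 0"
    then have "\<And>i. i \<in> I \<Longrightarrow> a i = 0"
      using ab b \<open>finite I\<close> by (simp add: B_def sum_nonneg_eq_0_iff)
    with False show False by simp
  qed
  then have B: "B > 0" using b sum_nonneg[of I b] by (simp add: B_def)
  have "a i * ln (b i / a i) \<le> a i * ln (B / A) + (b i * A / B - a i)" if i: "i \<in> I" for i
  proof (cases "a i = 0")
    case True
    then show ?thesis using A B b[OF i] by simp
  next
    case False
    then have ai: "a i > 0" and bi: "b i > 0" using a[OF i] b[OF i] ab[OF i] by fastforce+
    have "ln (b i / a i) - ln (B / A) = ln (b i * A / (a i * B))"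
      using ai bi A B by (simp add: ln_div ln_mult)
    also have "\<dots> \<le> b i * A / (a i * B) - 1"
      using ai bi A B by (intro ln_le_minus_one) simp
    finally have "a i * (ln (b i / a i) - ln (B / A)) \<le> a i * (b i * A / (a i * B) - 1)"
      using ai by (intro mult_left_mono) auto
    also have "\<dots> = b i * A / B - a i" using ai B by (simp add: field_simps)
    finally show ?thesis by (simp add: algebra_simps)
  qed
  then have "(\<Sum>i\<in>I. a i * ln (b i / a i)) \<le> (\<Sum>i\<in>I. a i * ln (B / A) + (b i * A / B - a i))"
    by (intro sum_mono)
  also have "\<dots> = A * ln (B / A) + (B * A / B - A)"
    by (simp add: sum.distrib sum_subtractf A_def B_def flip: sum_distrib_right sum_divide_distrib)
  also have "\<dots> = A * ln (B / A)" using B by simp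
  finally have "(\<Sum>i\<in>I. a i * ln (b i / a i)) / ln 2 \<le> A * ln (B / A) / ln 2"
    by (intro divide_right_mono) auto
  then show ?thesis by (simp add: log_def sum_divide_distrib A_def B_def)
qed

lemma log2_powers: "log 2 (4::real) = 2" "log 2 (16::real) = 4"
  using log_pow_cancel[of 2 2] log_pow_cancel[of 2 4] by simp_all

section \<open>Entropy of finite families of nonnegative weights\<close>

lemma mult_log_quotient:
  assumes "0 \<le> x" "x \<le> y"
  shows "x * log 2 (y / x) = ent x + x * log 2 y"
  using assms by (cases "x = 0") (auto simp: ent_def log_divide algebra_simps)

text \<open>For positive total mass, both sides are that mass times the Shannon entropy of the
  normalized family. The left form is the one to which \<open>log_sum_inequality\<close>
  applies.\<close>

lemma sum_mult_log_quotient: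
  assumes "finite J" and "\<And>j. j \<in> J \<Longrightarrow> 0 \<le> x j"
  shows "(\<Sum>j\<in>J. x j * log 2 (sum x J / x j)) = (\<Sum>j\<in>J. ent (x j)) - ent (sum x J)"
proof -
  have "(\<Sum>j\<in>J. x j * log 2 (sum x J / x j)) = (\<Sum>j\<in>J. ent (x j) + x j * log 2 (sum x J))"
    using assms by (intro sum.cong refl mult_log_quotient) (auto intro: member_le_sum)
  then show ?thesis by (simp add: sum.distrib sum_distrib_right ent_def[of "sum x J"])
qed

lemma ent_sum_le:
  assumes "finite J" and x: "\<And>j. j \<in> J \<Longrightarrow> 0 \<le> x j"
  shows "ent (sum x J) \<le> (\<Sum>j\<in>J. ent (x j))"
proof -
  have "0 \<le> x j * log 2 (sum x J / x j)" if "j \<in> J" for j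
  proof (cases "x j = 0")
    case False
    then have "x j > 0" "x j \<le> sum x J" using x that \<open>finite J\<close> by (fastforce intro: member_le_sum)+
    then show ?thesis by simp
  qed simp
  then have "0 \<le> (\<Sum>j\<in>J. x j * log 2 (sum x J / x j))" by (intro sum_nonneg)
  then show ?thesis using sum_mult_log_quotient[of J x] assms by simp
qed

lemma ent_add_le:
  assumes "0 \<le> x" "0 \<le> y"
  shows "ent (x + y) \<le> ent x + ent y"
  \<comment> \<open>\<open>bool\<close> serves as a two-element index set, here and in later
    two-term cases.\<close>
  using ent_sum_le[of "UNIV :: bool set" "\<lambda>b. if b then x else y"] assms
  by (simp add: UNIV_bool add.commute)

text \<open>Entropy is largest for the uniform distribution: \<open>log_sum_inequality\<close>
  against the constant family \<open>1\<close>.\<close>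

lemma sum_ent_diff_le_card:
  assumes "finite J" and x: "\<And>j. j \<in> J \<Longrightarrow> 0 \<le> x j"
  shows "(\<Sum>j\<in>J. ent (x j)) - ent (sum x J) \<le> sum x J * log 2 (card J)"
proof (cases "sum x J = 0")
  case True
  then have "\<And>j. j \<in> J \<Longrightarrow> x j = 0"
    using x \<open>finite J\<close> by (simp add: sum_nonneg_eq_0_iff)
  then show ?thesis using True by (simp add: ent_def)
next
  case False
  then have "J \<noteq> {}" "sum x J > 0" using x sum_nonneg[of J x] by auto
  have "x j * log 2 (1 / x j) = ent (x j)" if "j \<in> J" for j
    using x[OF that] by (cases "x j = 0") (auto simp: ent_def log_divide)
  then have "(\<Sum>j\<in>J. ent (x j)) \<le> sum x J * log 2 (card J / sum x J)"
    using log_sum_inequality[of J x "\<lambda>_. 1"] assms by simp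
  also have "\<dots> = sum x J * log 2 (card J) + ent (sum x J)"
    using \<open>J \<noteq> {}\<close> \<open>sum x J > 0\<close> \<open>finite J\<close>
    by (simp add: log_divide ent_def algebra_simps)
  finally show ?thesis by simp
qed

text \<open>The functional "sum of \<open>ent\<close> minus \<open>ent\<close> of the sum" is
  homogeneous of degree one, so this is concavity of entropy. For each fixed \<open>j\<close> it is
  the log-sum inequality with the row totals as \<open>b\<close>.\<close>

lemma cond_ent_superadditive:
  fixes x :: "'i \<Rightarrow> 'j \<Rightarrow> real"
  assumes "finite I" "finite J" and x: "\<And>i j. i \<in> I \<Longrightarrow> j \<in> J \<Longrightarrow> 0 \<le> x i j"
  shows "(\<Sum>i\<in>I. (\<Sum>j\<in>J. ent (x i j)) - ent (\<Sum>j\<in>J. x i j))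
    \<le> (\<Sum>j\<in>J. ent (\<Sum>i\<in>I. x i j)) - ent (\<Sum>j\<in>J. \<Sum>i\<in>I. x i j)"
proof -
  have "(\<Sum>i\<in>I. (\<Sum>j\<in>J. ent (x i j)) - ent (\<Sum>j\<in>J. x i j))
      = (\<Sum>i\<in>I. \<Sum>j\<in>J. x i j * log 2 ((\<Sum>j\<in>J. x i j) / x i j))"
    using assms by (intro sum.cong refl sum_mult_log_quotient[symmetric]) auto
  also have "\<dots> = (\<Sum>j\<in>J. \<Sum>i\<in>I. x i j * log 2 ((\<Sum>j\<in>J. x i j) / x i j))"
    by (rule sum.swap)
  also have "\<dots> \<le> (\<Sum>j\<in>J. (\<Sum>i\<in>I. x i j) * log 2 ((\<Sum>i\<in>I. \<Sum>j\<in>J. x i j) / (\<Sum>i\<in>I. x i j)))"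
    using assms
    by (intro sum_mono log_sum_inequality) (auto intro: sum_nonneg simp: sum_nonneg_eq_0_iff)
  also have "\<dots> = (\<Sum>j\<in>J. ent (\<Sum>i\<in>I. x i j)) - ent (\<Sum>j\<in>J. \<Sum>i\<in>I. x i j)"
    using sum_mult_log_quotient[of J "\<lambda>j. \<Sum>i\<in>I. x i j"] assms
    by (simp add: sum.swap[of _ J I] sum_nonneg)
  finally show ?thesis .
qed

text \<open>Superadditivity for the two rows \<open>x\<close> and \<open>y\<close>; the contribution
  of \<open>y\<close> alone is nonnegative by \<open>ent_sum_le\<close>.\<close>

lemma sum_ent_add_diff_ge:
  assumes "finite J" and x: "\<And>j. j \<in> J \<Longrightarrow> 0 \<le> x j" and y: "\<And>j. j \<in> J \<Longrightarrow> 0 \<le> y j"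
  shows "(\<Sum>j\<in>J. ent (x j)) - ent (sum x J)
    \<le> (\<Sum>j\<in>J. ent (x j + y j)) - ent (\<Sum>j\<in>J. x j + y j)"
proof -
  have "0 \<le> (if b then x j else y j)" if "j \<in> J" for b j using x y that by simp
  from cond_ent_superadditive[of UNIV J "\<lambda>b j. if b then x j else y j", OF _ \<open>finite J\<close> this]
  show ?thesis using ent_sum_le[of J y] \<open>finite J\<close> y by (simp add: UNIV_bool add.commute)
qed

section \<open>Monotonicity of \<open>eta\<close> and the numeric estimate\<close>

lemma ent_mono:
  assumes "0 \<le> x" "x \<le> y" "y \<le> 1/4"
  shows "ent x \<le> ent y"
proof (cases "x = 0")
  case True
  then show ?thesis using assms by (cases "y = 0") (auto simp: ent_def mult_le_0_iff)
next
  case False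
  then have xy: "x > 0" "y > 0" using assms by auto
  \<comment> \<open>\<open>ent\<close> increases up to \<open>1/e\<close>; since \<open>1/4\<close>
    lies below that, \<open>ln y \<le> -1\<close>.\<close>
  have "log 2 y \<le> log 2 (1/4)" using xy assms by (subst log_le_cancel_iff) auto
  also have "log 2 (1/4::real) = -2" by (simp add: log_divide log2_powers)
  finally have "ln y \<le> -2 * ln 2" by (simp add: log_def field_simps)
  moreover have "ln 2 \<ge> (2/3::real)" by (rule ln2_ge_two_thirds)
  ultimately have l: "ln y \<le> -1" by simp
  have "ln (y / x) \<le> y / x - 1" using xy by (intro ln_le_minus_one) simp
  then have "x * ln (y / x) \<le> x * (y / x - 1)" using xy by (intro mult_left_mono) auto
  also have "x * (y / x - 1) = y - x" using xy by (simp add: field_simps)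
  finally have "x * (ln y - ln x) \<le> y - x" using xy by (simp add: ln_div)
  moreover have "(y - x) * (ln y + 1) \<le> 0" using l assms by (intro mult_nonneg_nonpos) auto
  \<comment> \<open>Uses \<open>y * ln y - x * ln x = (y - x) * ln y + x * (ln y - ln x)\<close>,
    which is at most \<open>(y - x) * (ln y + 1)\<close>.\<close>
  ultimately have "y * ln y \<le> x * ln x" by (simp add: algebra_simps)
  then show ?thesis by (simp add: ent_def log_def divide_right_mono)
qed

text \<open>The two branches of \<open>eta\<close> meet at \<open>1/4\<close>, so monotonicity
  extends across the junction.\<close>

lemma ent_quarter: "ent (1/4) = 1/2"
proof -
  have "log 2 (1/4::real) = -2" by (simp add: log_divide log2_powers)
  then show ?thesis by (simp add: ent_def)
qed

lemma eta_eq: "eta x = (if x \<le> 1/4 then ent x else 1/2)"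
  by (simp add: eta_def ent_def)

lemma eta_mono:
  assumes "0 \<le> x" "x \<le> y"
  shows "eta x \<le> eta y"
  using assms ent_mono[of x y] ent_mono[of x "1/4"] by (auto simp: eta_eq ent_quarter)

lemma eta_nonneg: "0 \<le> x \<Longrightarrow> 0 \<le> eta x"
  using eta_mono[of 0 x] by (simp add: eta_def)

text \<open>Shaped for trace distance \<open>2 * t\<close>: then \<open>2 * \<epsilon>\<close>
  becomes \<open>4 * t\<close>, and \<open>5 * t\<close> is what the budget
  \<open>6 * t * log d\<close> still offers after spending \<open>t * log d\<close>, once
  \<open>log d \<ge> 1\<close>.\<close>

lemma ent_diff_le_eta:
  assumes "0 \<le> t" "t \<le> 1"
  shows "ent t - ent (1 + t) \<le> eta (4 * t) + 5 * t"
proof (cases "t = 0")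
  case True
  then show ?thesis by (simp add: ent_def eta_def)
next
  case False
  then have t: "t > 0" using assms by simp
  have "ln (1 + t) \<le> t" using t by (intro ln_add_one_self_le_self2) simp
  \<comment> \<open>The factor \<open>3/2\<close> is the reciprocal of the lower bound
    \<open>2/3\<close> for \<open>ln 2\<close>.\<close>
  also have "t \<le> (3/2 * t) * ln 2" using t ln2_ge_two_thirds by simp
  finally have l: "log 2 (1 + t) \<le> 3/2 * t" by (simp add: log_def field_simps)
  have l': "log 2 (1 + t) \<le> 1" using assms t by (simp add: log_le_iff)
  show ?thesis
  proof (cases "4 * t \<le> 1/4")
    case True
    have 1: "log 2 (4 * t) = 2 + log 2 t" using t by (simp add: log_mult log2_powers)
    \<comment> \<open>As \<open>t \<le> 1/16\<close>, the three surplus copies of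
      \<open>- t * log 2 t\<close> in \<open>eta (4 * t)\<close> are worth at least
      \<open>12 * t\<close>, which covers the remaining \<open>8 * t\<close> and the logarithms of
      \<open>1 + t\<close>.\<close>
    have "log 2 t \<le> log 2 (1/16)" using t True by (subst log_le_cancel_iff) auto
    also have "log 2 (1/16::real) = -4" by (simp add: log_divide log2_powers)
    finally have "t * log 2 t \<le> t * (-4)" using t by (intro mult_left_mono) auto
    moreover have "t * log 2 (1 + t) \<le> t * 1" using l' t by (intro mult_left_mono) auto
    moreover have "eta (4 * t) = - 8 * t - 4 * (t * log 2 t)"
      unfolding eta_def 1 using True by (simp add: algebra_simps)
    moreover have "ent t - ent (1 + t) = log 2 (1 + t) + t * log 2 (1 + t) - t * log 2 t"
      by (simp add: ent_def algebra_simps)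
    ultimately show ?thesis using l t by linarith
  next
    case False
    \<comment> \<open>The tangent at \<open>t = 1/4\<close> gives
      \<open>- t * log 2 t \<le> 3/8 + 2 * t\<close>, so the left side of the goal is at most
      \<open>3/8 + 9/2 * t\<close>.\<close>
    have "ln (1 / (4 * t)) \<le> 1 / (4 * t) - 1" using t by (intro ln_le_minus_one) simp
    then have "t * ln (1 / (4 * t)) \<le> t * (1 / (4 * t) - 1)" using t by (intro mult_left_mono) auto
    also have "\<dots> \<le> 1/4" using t by (simp add: field_simps)
    also have "\<dots> \<le> 3/8 * ln 2" using ln2_ge_two_thirds by simp
    finally have "t * log 2 (1 / (4 * t)) \<le> 3/8" by (simp add: log_def field_simps)
    moreover have "log 2 (1 / (4 * t)) = - 2 - log 2 t"
      using t by (simp add: log_divide log_mult log2_powers)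
    ultimately have "t * (- 2 - log 2 t) \<le> 3/8" by simp
    moreover have "t * log 2 (1 + t) \<le> t * 1" using l' t by (intro mult_left_mono) auto
    moreover have "t * (- 2 - log 2 t) = - 2 * t - t * log 2 t"
      by (simp add: algebra_simps)
    moreover have "ent t - ent (1 + t) = log 2 (1 + t) + t * log 2 (1 + t) - t * log 2 t"
      by (simp add: ent_def algebra_simps)
    moreover have "eta (4 * t) = 1/2" using False by (simp add: eta_def)
    ultimately show ?thesis using l t by linarith
  qed
qed

text \<open>Both distributions are compared with their pointwise maximum
  \<open>x + n = y + t\<close>. Going up from \<open>x\<close> cannot lower \<open>F\<close>, and
  going up from \<open>y\<close> costs an amount governed by the mass \<open>T\<close> of
  \<open>t\<close>.\<close>

lemma classical_cond_ent_continuity: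
  fixes x y :: "'a::finite \<times> 'b::finite \<Rightarrow> real"
  assumes x: "\<And>i. 0 \<le> x i" "sum x UNIV = 1" and y: "\<And>i. 0 \<le> y i" "sum y UNIV = 1"
    and \<epsilon>: "(\<Sum>i\<in>UNIV. \<bar>x i - y i\<bar>) \<le> \<epsilon>"
  defines "F \<equiv> \<lambda>z. (\<Sum>i\<in>UNIV. ent (z i)) - (\<Sum>k\<in>UNIV. ent (\<Sum>j\<in>UNIV. z (j, k)))"
  shows "F x - F y \<le> eta (2 * \<epsilon>) + 3 * \<epsilon> * log 2 (real CARD('a))"
proof -
  have F: "F z = (\<Sum>k\<in>UNIV. (\<Sum>j\<in>UNIV. ent (z (j, k))) - ent (\<Sum>j\<in>UNIV. z (j, k)))" for z
    unfolding F_def UNIV_Times_UNIV[symmetric]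
    by (subst sum.cartesian_product', subst sum.swap) (simp add: sum_subtractf)
  have \<epsilon>0: "0 \<le> \<epsilon>" using \<epsilon> by (meson abs_ge_zero order_trans sum_nonneg)
  show ?thesis
  proof (cases "CARD('a) = 1")
    case True
    \<comment> \<open>Here \<open>log 2 1 = 0\<close> cannot absorb a linear term, but
      \<open>F\<close> vanishes identically.\<close>
    then obtain a where a: "(UNIV :: 'a set) = {a}" by (auto simp: card_1_singleton_iff)
    then have "F z = 0" for z by (simp add: F a)
    then show ?thesis using True \<epsilon>0 by (simp add: eta_nonneg)
  next
    case False
    moreover have "CARD('a) > 0" by simp
    ultimately have "CARD('a) \<ge> 2" by linarith
    then have L: "log 2 (real CARD('a)) \<ge> 1" by (simp add: le_log_iff)
    define n t where "n = (\<lambda>i. max 0 (y i - x i))" and "t = (\<lambda>i. max 0 (x i - y i))"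
    define T where "T = sum t UNIV"
    have nt: "0 \<le> n i" "0 \<le> t i" "x i + n i = y i + t i" "t i \<le> x i"
      "\<bar>x i - y i\<bar> = 2 * t i - (x i - y i)" for i
      using x(1) y(1) by (auto simp: n_def t_def max_def)
    have T0: "0 \<le> T" unfolding T_def using nt by (intro sum_nonneg) auto
    have T1: "T \<le> 1" unfolding T_def x(2)[symmetric] using nt by (intro sum_mono) auto
    \<comment> \<open>The differences \<open>x i - y i\<close> sum to zero because both total masses
      are \<open>1\<close>.\<close>
    have "(\<Sum>i\<in>UNIV. \<bar>x i - y i\<bar>) = 2 * T"
      by (simp add: nt(5) sum_subtractf x(2) y(2) T_def sum_distrib_left)
    then have T2: "2 * T \<le> \<epsilon>" using \<epsilon> by simp
    define yB tB where "yB = (\<lambda>k. \<Sum>j\<in>UNIV. y (j, k))" and "tB = (\<lambda>k. \<Sum>j\<in>UNIV. t (j, k))"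
    have B0: "0 \<le> yB k" "0 \<le> tB k" for k
      unfolding yB_def tB_def using y nt by (auto intro: sum_nonneg)
    have marg: "(\<Sum>k\<in>UNIV. \<Sum>j\<in>UNIV. z (j, k)) = sum z UNIV" for z :: "'a \<times> 'b \<Rightarrow> real"
      unfolding UNIV_Times_UNIV[symmetric] by (subst sum.cartesian_product', subst sum.swap) simp
    have "F x \<le> F (\<lambda>i. x i + n i)"
      unfolding F using x(1) nt by (intro sum_mono sum_ent_add_diff_ge) auto
    also have "\<dots> = F (\<lambda>i. y i + t i)" by (simp add: nt)
    \<comment> \<open>Only the joint terms are split by subadditivity; the marginal terms
      \<open>ent (yB k + tB k)\<close> stay whole for the next bound.\<close>
    also have "\<dots> \<le> (\<Sum>k\<in>UNIV. (\<Sum>j\<in>UNIV. ent (y (j, k)) + ent (t (j, k))) - ent (yB k + tB k))"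
      unfolding F yB_def tB_def using y(1) nt
      by (intro sum_mono diff_mono ent_add_le) (auto simp: sum.distrib)
    also have "\<dots> = F y + F t + (\<Sum>k\<in>UNIV. ent (yB k) + ent (tB k) - ent (yB k + tB k))"
      unfolding F by (simp add: sum.distrib sum_subtractf yB_def tB_def)
    \<comment> \<open>Superadditivity over \<open>k\<close> for the entropy of the label telling
      \<open>y\<close> from \<open>t\<close>; the totals are \<open>1\<close> and
      \<open>T\<close>.\<close>
    also have "(\<Sum>k\<in>UNIV. ent (yB k) + ent (tB k) - ent (yB k + tB k))
        \<le> ent (\<Sum>k\<in>UNIV. yB k) + ent (\<Sum>k\<in>UNIV. tB k) - ent ((\<Sum>k\<in>UNIV. yB k) + (\<Sum>k\<in>UNIV. tB k))"
      using cond_ent_superadditive[of "UNIV :: 'b set" "UNIV :: bool set"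
          "\<lambda>k b. if b then yB k else tB k"] B0
      by (simp add: UNIV_bool add.commute)
    also have "\<dots> = ent T - ent (1 + T)"
      by (simp add: yB_def tB_def marg y(2) T_def[symmetric]) (simp add: ent_def)
    also have "\<dots> \<le> eta (4 * T) + 5 * T" by (rule ent_diff_le_eta[OF T0 T1])
    also have "eta (4 * T) \<le> eta (2 * \<epsilon>)" using T0 T2 by (intro eta_mono) auto
    also have "F t \<le> (\<Sum>k\<in>UNIV. (\<Sum>j\<in>UNIV. t (j, k)) * log 2 (real CARD('a)))"
      unfolding F using nt by (intro sum_mono sum_ent_diff_le_card) auto
    also have "\<dots> = T * log 2 (real CARD('a))"
      by (simp add: marg T_def flip: sum_distrib_right)
    finally have "F x - F y \<le> T * log 2 (real CARD('a)) + (eta (2 * \<epsilon>) + 5 * T)" by simp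
    also have "T * 1 \<le> T * log 2 (real CARD('a))" using L T0 by (intro mult_left_mono)
    then have "T * log 2 (real CARD('a)) + (eta (2 * \<epsilon>) + 5 * T)
        \<le> eta (2 * \<epsilon>) + 3 * (2 * T) * log 2 (real CARD('a))" by simp
    also have "\<dots> \<le> eta (2 * \<epsilon>) + 3 * \<epsilon> * log 2 (real CARD('a))"
      using T2 L by (intro add_left_mono mult_right_mono) auto
    finally show ?thesis .
  qed
qed

section \<open>The spectral theorem for Hermitian matrices\<close>

lemma cinner_add_right: "cinner v (x + y) = cinner v x + cinner v y"
  by (simp add: cinner_def algebra_simps sum.distrib)

lemma cinner_diff_right: "cinner v (x - y) = cinner v x - cinner v y"
  by (simp add: cinner_def algebra_simps sum_subtractf)

lemma cinner_scaleR_right: "cinner v (c *\<^sub>R x) = of_real c * cinner v x"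
  by (simp add: cinner_def scaleR_sum_right[symmetric]) (simp add: scaleR_conv_of_real)

lemma cinner_scaleR_left: "cinner (c *\<^sub>R v) x = of_real c * cinner v x"
  by (simp add: cinner_def scaleR_sum_right[symmetric]) (simp add: scaleR_conv_of_real)

lemma cinner_mult_left: "cinner (c *s v) x = cnj c * cinner v x"
  by (simp add: cinner_def sum_distrib_left mult_ac)

lemma cinner_mult_right: "cinner v (c *s x) = c * cinner v x"
  by (simp add: cinner_def sum_distrib_left mult_ac)

lemma cinner_sum_right: "cinner v (\<Sum>i\<in>I. f i) = (\<Sum>i\<in>I. cinner v (f i))"
  by (simp add: cinner_def sum_distrib_left sum.swap[of _ UNIV I])

lemma cnj_cinner: "cnj (cinner v w) = cinner w v"
  by (simp add: cinner_def mult.commute)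

lemma Re_cinner: "Re (cinner v w) = v \<bullet> w"
  by (simp add: cinner_def inner_vec_def inner_complex_def)

lemma cinner_matrix_vector: "cinner v (A *v w) = cinner (adjoint_mat A *v v) w"
  unfolding cinner_def matrix_vector_mult_def adjoint_mat_def
  by (simp add: sum_distrib_left sum_distrib_right) (subst sum.swap, simp add: mult_ac)

lemma matrix_vector_scaleR_complex: "(A :: complex^'n^'m) *v (c *\<^sub>R v) = c *\<^sub>R (A *v v)"
  by (simp add: vec_eq_iff matrix_vector_mult_def scaleR_sum_right)

lemma continuous_on_cinner: "continuous_on S (cinner v)"
  unfolding cinner_def by (intro continuous_intros)

text \<open>The quadratic form of \<open>A\<close> attains its maximum on the unit sphere of the
  orthogonal complement \<open>V\<close> of the eigenvectors found so far; as \<open>V\<close> is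
  invariant under \<open>A\<close>, a maximizer is an eigenvector.\<close>

lemma hermitian_eigenvector_orthogonal:
  fixes A :: "complex^'n^'n" and e :: "'i \<Rightarrow> complex^'n"
  assumes adj: "adjoint_mat A = A" and "finite I" and card: "card I < CARD('n)"
    and eig: "\<And>i. i \<in> I \<Longrightarrow> A *v e i = d i *\<^sub>R e i"
  shows "\<exists>v c. cinner v v = 1 \<and> A *v v = c *\<^sub>R v \<and> (\<forall>i\<in>I. cinner (e i) v = 0)"
proof -
  define V where "V = {v. \<forall>i\<in>I. cinner (e i) v = 0}"
  have "V = (\<Inter>i\<in>I. {v. cinner (e i) v = 0})" by (auto simp: V_def)
  also have "closed \<dots>"
    by (intro closed_INT ballI closed_Collect_eq continuous_on_cinner continuous_on_const)
  finally have "closed V" .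
  have Vscale: "a *\<^sub>R u \<in> V" if "u \<in> V" for a u
    using that by (simp add: V_def cinner_scaleR_right)
  have sym: "x \<bullet> (A *v y) = (A *v x) \<bullet> y" for x y
    using cinner_matrix_vector[of x A y] by (simp add: adj flip: Re_cinner)
  \<comment> \<open>Real orthogonality to both \<open>e i\<close> and \<open>\<i> *s e i\<close> is
    complex orthogonality to \<open>e i\<close>. The real span of \<open>B\<close> has dimension at
    most \<open>2 * card I\<close>, below the real dimension \<open>2 * CARD('n)\<close> of the
    space.\<close>
  define B where "B = e ` I \<union> (\<lambda>i. \<i> *s e i) ` I"
  have "dim B \<le> card B" using \<open>finite I\<close> by (intro dim_le_card') (simp add: B_def)
  also have "\<dots> \<le> card (e ` I) + card ((\<lambda>i. \<i> *s e i) ` I)" unfolding B_def by (rule card_Un_le)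
  also have "\<dots> \<le> card I + card I" by (intro add_mono card_image_le \<open>finite I\<close>)
  also have "\<dots> < DIM(complex^'n)" using card by simp
  finally obtain x0 where x0: "x0 \<noteq> 0" "\<And>y. y \<in> span B \<Longrightarrow> orthogonal x0 y"
    using orthogonal_to_subspace_exists by blast
  have "cinner (e i) x0 = 0" if "i \<in> I" for i
  proof (rule complex_eqI)
    have "e i \<in> span B" "\<i> *s e i \<in> span B" using that by (auto simp: B_def intro: span_base)
    then have "x0 \<bullet> e i = 0" "x0 \<bullet> (\<i> *s e i) = 0" using x0 by (auto simp: orthogonal_def)
    then have "Re (cinner (e i) x0) = 0" "Re (cinner (\<i> *s e i) x0) = 0"
      by (simp_all add: Re_cinner inner_commute)
    then show "Re (cinner (e i) x0) = Re 0" "Im (cinner (e i) x0) = Im 0"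
      by (simp_all add: cinner_mult_left)
  qed
  then have "x0 \<in> V" by (simp add: V_def)
  then have "(1 / norm x0) *\<^sub>R x0 \<in> V \<inter> sphere 0 1" using Vscale x0(1) by simp
  then have ne: "V \<inter> sphere 0 1 \<noteq> {}" by blast
  have "continuous_on (V \<inter> sphere 0 1) (\<lambda>v. v \<bullet> (A *v v))"
    unfolding Re_cinner[symmetric] cinner_def matrix_vector_mult_def vec_lambda_beta
    by (intro continuous_intros)
  moreover have "compact (V \<inter> sphere 0 1)"
    by (intro closed_Int_compact \<open>closed V\<close> compact_sphere)
  ultimately have "\<exists>v\<in>V \<inter> sphere 0 1. \<forall>u\<in>V \<inter> sphere 0 1. u \<bullet> (A *v u) \<le> v \<bullet> (A *v v)"
    using ne by (intro continuous_attains_sup)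
  then obtain v where v: "v \<in> V" "norm v = 1"
    and max: "\<And>u. u \<in> V \<Longrightarrow> norm u = 1 \<Longrightarrow> u \<bullet> (A *v u) \<le> v \<bullet> (A *v v)"
    by auto
  define c where "c = v \<bullet> (A *v v)"
  define w where "w = A *v v - c *\<^sub>R v"
  \<comment> \<open>\<open>N\<close> is the squared norm of the residual \<open>w\<close>, and
    \<open>K\<close> collects the second-order terms of the perturbation
    \<open>v + t *\<^sub>R w\<close>.\<close>
  define N K where "N = w \<bullet> w" and "K = c * N - w \<bullet> (A *v w)"
  have vv: "v \<bullet> v = 1" using v(2) by (simp add: norm_eq_1)
  have "w \<in> V"
    using v(1) by (simp add: V_def w_def cinner_diff_right cinner_scaleR_right cinner_scaleR_left
        cinner_matrix_vector adj eig)
  have bound: "u \<bullet> (A *v u) \<le> c * (u \<bullet> u)" if "u \<in> V" for u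
  proof (cases "u = 0")
    case False
    have "(1 / norm u) *\<^sub>R u \<bullet> (A *v ((1 / norm u) *\<^sub>R u)) \<le> c"
      unfolding c_def using False Vscale[OF that] by (intro max) auto
    then have "(u \<bullet> (A *v u)) / (norm u * norm u) \<le> c"
      by (simp add: matrix_vector_scaleR_complex)
    then show ?thesis using False by (simp add: field_simps dot_square_norm power2_eq_square)
  qed simp
  have wv: "w \<bullet> v = 0"
    by (simp add: w_def inner_diff_left vv) (simp add: c_def inner_commute)
  have wAv: "w \<bullet> (A *v v) = N"
  proof -
    have "A *v v = w + c *\<^sub>R v" by (simp add: w_def)
    then show ?thesis by (simp add: inner_add_right wv N_def)
  qed
  \<comment> \<open>Moving the maximizer in the direction of the residual \<open>w\<close> would gain to first order.\<close>
  have step: "2 * t * N \<le> t * t * K" for t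
  proof -
    have "v + t *\<^sub>R w \<in> V"
      using v(1) \<open>w \<in> V\<close> by (simp add: V_def cinner_add_right cinner_scaleR_right)
    from bound[OF this] show ?thesis
      using wv wAv vv sym[of v w]
      by (simp add: matrix_vector_right_distrib matrix_vector_scaleR_complex inner_add_left
          inner_add_right inner_commute[of v w] inner_commute[of "A *v v" w] K_def
          flip: c_def N_def) (simp add: algebra_simps)
  qed
  have "N \<le> 0"
  proof (rule ccontr)
    assume "\<not> N \<le> 0"
    then have N: "N > 0" by simp
    \<comment> \<open>\<open>step\<close> divided by \<open>t\<close> reads
      \<open>2 * N \<le> t * K\<close>; this choice makes the right side at most
      \<open>N\<close>.\<close>
    define t where "t = N / (\<bar>K\<bar> + 1)"
    have t: "t > 0" using N by (simp add: t_def)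
    have "2 * N \<le> t * K" using step[of t] t by (simp add: mult_ac)
    also have "\<dots> \<le> t * (\<bar>K\<bar> + 1)" using t by (intro mult_left_mono) auto
    also have "\<dots> = N" by (simp add: t_def)
    finally show False using N by simp
  qed
  then have "w = 0" using inner_ge_zero[of w] by (simp add: N_def order_antisym)
  then have "A *v v = c *\<^sub>R v" by (simp add: w_def)
  moreover have "cinner v v = 1"
  proof (rule complex_eqI)
    show "Re (cinner v v) = Re 1" by (simp add: Re_cinner vv)
    show "Im (cinner v v) = Im 1" using cnj_cinner[of v v] by (simp add: complex_eq_iff)
  qed
  ultimately show ?thesis using v(1) by (auto simp: V_def)
qed

text \<open>Induction on the set of indices already served: a proper subset always leaves room for
  one more orthogonal eigenvector.\<close>

lemma hermitian_orthonormal_eigenbasis: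
  fixes A :: "complex^'n^'n"
  assumes adj: "adjoint_mat A = A"
  obtains e d where "orthonormal_basis e" "\<And>j. A *v e j = d j *\<^sub>R e j"
proof -
  have "\<exists>e d. (\<forall>i\<in>I. \<forall>j\<in>I. cinner (e i) (e j) = (if i = j then 1 else 0))
      \<and> (\<forall>j\<in>I. A *v e j = d j *\<^sub>R e j)" for I :: "'n set"
  proof (induction I rule: finite_induct[OF finite])
    case (2 x I)
    then obtain e d where e: "\<And>i j. i \<in> I \<Longrightarrow> j \<in> I \<Longrightarrow> cinner (e i) (e j) = (if i = j then 1 else 0)"
      and d: "\<And>j. j \<in> I \<Longrightarrow> A *v e j = d j *\<^sub>R e j" by metis
    have "card I < CARD('n)" using \<open>x \<notin> I\<close> by (intro psubset_card_mono) auto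
    then obtain v c where v: "cinner v v = 1" "A *v v = c *\<^sub>R v" "\<And>i. i \<in> I \<Longrightarrow> cinner (e i) v = 0"
      using hermitian_eigenvector_orthogonal[OF adj, of I e d] d \<open>finite I\<close> by blast
    have v': "cinner v (e i) = 0" if "i \<in> I" for i
      using v(3)[OF that] cnj_cinner[of "e i" v] by simp
    show ?case
      using e d v v' \<open>x \<notin> I\<close>
      by (intro exI[of _ "e(x := v)"] exI[of _ "d(x := c)"]) auto
  qed simp
  from this[of UNIV] that show ?thesis by (auto simp: orthonormal_basis_def)
qed

section \<open>Spectral decompositions and their calculus\<close>

definition spectral :: "('n \<Rightarrow> complex^'n) \<Rightarrow> ('n \<Rightarrow> real) \<Rightarrow> complex^'n^'n" where
  "spectral e d = (\<Sum>j\<in>UNIV. d j *\<^sub>R ket_bra (e j) (e j))"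

definition basis_mat :: "('n \<Rightarrow> complex^'n) \<Rightarrow> complex^'n^'n" where
  "basis_mat e = (\<chi> i j. e j $ i)"

lemma unitary_basis_mat:
  assumes "orthonormal_basis e"
  shows "unitary_mat (basis_mat e)"
proof -
  have "adjoint_mat (basis_mat e) ** basis_mat e = mat 1"
    using assms
    by (simp add: vec_eq_iff matrix_matrix_mult_def adjoint_mat_def basis_mat_def mat_def
        orthonormal_basis_def cinner_def)
  then show ?thesis by (simp add: unitary_mat_def matrix_left_right_inverse)
qed

lemma diag_mat_mult: "diag_mat c ** diag_mat d = diag_mat (\<lambda>i. c i * d i)"
proof -
  have "(\<Sum>k\<in>UNIV. (if i = k then complex_of_real (c i) else 0) * (if k = j then of_real (d k) else 0))
      = (\<Sum>k\<in>UNIV. if i = k then (if k = j then of_real (c k) * of_real (d k) else 0) else 0)" for i j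
    by (intro sum.cong) auto
  then show ?thesis by (simp add: vec_eq_iff diag_mat_def matrix_matrix_mult_def)
qed

lemma spectral_entry: "spectral e d $ i $ j = (\<Sum>k\<in>UNIV. of_real (d k) * e k $ i * cnj (e k $ j))"
  by (simp add: spectral_def ket_bra_def) (simp add: scaleR_conv_of_real mult_ac)

text \<open>Bridge to the form on which \<open>fun_op_unitary_diag\<close> evaluates
  \<open>fun_op\<close>.\<close>

lemma spectral_eq_conj_diag: "spectral e d = basis_mat e ** diag_mat d ** adjoint_mat (basis_mat e)"
proof -
  have "(\<Sum>l\<in>UNIV. e l $ i * (if l = k then complex_of_real (d l) else 0)) = of_real (d k) * e k $ i" for i k
    by (subst sum.mono_neutral_right[of _ "{k}"]) auto
  then show ?thesis
    by (simp add: vec_eq_iff spectral_entry matrix_matrix_mult_def diag_mat_def basis_mat_def adjoint_mat_def)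
qed

lemma fun_op_spectral:
  "orthonormal_basis e \<Longrightarrow> fun_op f (spectral e d) = spectral e (\<lambda>i. f (d i))"
  by (simp add: spectral_eq_conj_diag fun_op_unitary_diag unitary_basis_mat)

lemma spectral_mult:
  assumes "orthonormal_basis e"
  shows "spectral e c ** spectral e d = spectral e (\<lambda>i. c i * d i)"
proof -
  let ?U = "basis_mat e"
  have "spectral e c ** spectral e d
      = ?U ** diag_mat c ** (adjoint_mat ?U ** ?U) ** diag_mat d ** adjoint_mat ?U"
    by (simp add: spectral_eq_conj_diag matrix_mul_assoc)
  also have "\<dots> = ?U ** (diag_mat c ** diag_mat d) ** adjoint_mat ?U"
    using unitary_basis_mat[OF assms] by (simp add: unitary_mat_def matrix_mul_assoc)
  finally show ?thesis by (simp add: diag_mat_mult spectral_eq_conj_diag)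
qed

lemma trace_spectral:
  assumes "orthonormal_basis e"
  shows "trace (spectral e d) = of_real (sum d UNIV)"
proof -
  have "trace (spectral e d) = (\<Sum>j\<in>UNIV. \<Sum>i\<in>UNIV. of_real (d j) * e j $ i * cnj (e j $ i))"
    unfolding trace_def spectral_entry by (rule sum.swap)
  also have "\<dots> = (\<Sum>j\<in>UNIV. of_real (d j) * cinner (e j) (e j))"
    by (simp add: cinner_def sum_distrib_left mult_ac)
  finally show ?thesis using assms by (simp add: orthonormal_basis_def)
qed

lemma adjoint_mat_spectral: "adjoint_mat (spectral e d) = spectral e d"
  by (simp add: vec_eq_iff adjoint_mat_def spectral_entry mult_ac)

lemma diag_mat_one: "diag_mat (\<lambda>_. 1) = mat 1"
  by (simp add: vec_eq_iff diag_mat_def mat_def)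

lemma spectral_one:
  assumes "orthonormal_basis e"
  shows "spectral e (\<lambda>_. 1) = mat 1"
  using unitary_basis_mat[OF assms] by (simp add: spectral_eq_conj_diag unitary_mat_def diag_mat_one)

lemma spectral_vector: "spectral e d *v v = (\<Sum>j\<in>UNIV. d j *\<^sub>R (cinner (e j) v *s e j))"
proof -
  have "(spectral e d *v v) $ i = (\<Sum>j\<in>UNIV. d j *\<^sub>R (cinner (e j) v *s e j)) $ i" for i
  proof -
    have "(spectral e d *v v) $ i
        = (\<Sum>j\<in>UNIV. \<Sum>k\<in>UNIV. of_real (d j) * e j $ i * cnj (e j $ k) * v $ k)"
      unfolding matrix_vector_mult_def vec_lambda_beta spectral_entry sum_distrib_right
      by (rule sum.swap)
    also have "\<dots> = (\<Sum>j\<in>UNIV. of_real (d j) * (cinner (e j) v * e j $ i))"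
      by (simp add: cinner_def sum_distrib_left sum_distrib_right mult_ac)
    finally show ?thesis by (simp add: scaleR_conv_of_real[where 'a = complex])
  qed
  then show ?thesis by (simp add: vec_eq_iff)
qed

text \<open>A diagonal entry in a second orthonormal basis is thus an average of eigenvalues; by
  \<open>parseval\<close> the weights are doubly stochastic, which drives the later comparisons of
  diagonals.\<close>

lemma cinner_spectral:
  "cinner v (spectral e d *v v) = of_real (\<Sum>j\<in>UNIV. d j * (cmod (cinner (e j) v))\<^sup>2)"
proof -
  have "cinner x y * cinner y x = of_real ((cmod (cinner x y))\<^sup>2)" for x y :: "complex^'a"
    unfolding cnj_cinner[of x y, symmetric] by (simp only: complex_norm_square)
  then show ?thesis
    by (simp add: spectral_vector cinner_sum_right cinner_scaleR_right cinner_mult_right)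
qed

lemma parseval:
  assumes "orthonormal_basis e"
  shows "(\<Sum>j\<in>UNIV. (cmod (cinner (e j) v))\<^sup>2) = Re (cinner v v)"
  using cinner_spectral[of v e "\<lambda>_. 1"] by (simp add: spectral_one assms)

text \<open>Multiplying \<open>A\<close> by the resolution of the identity
  \<open>spectral_one\<close> lets it act on its own eigenvectors.\<close>

lemma hermitian_spectral:
  assumes "adjoint_mat A = A"
  obtains e d where "orthonormal_basis e" "A = spectral e d"
proof -
  obtain e d where e: "orthonormal_basis e" and d: "\<And>j. A *v e j = d j *\<^sub>R e j"
    using hermitian_orthonormal_eigenbasis[OF assms] by blast
  have eq: "(\<Sum>k\<in>UNIV. A $ i $ k * e l $ k) = of_real (d l) * e l $ i" for i l
    using arg_cong[OF d[of l], of "\<lambda>v. v $ i"]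
    by (simp add: matrix_vector_mult_def scaleR_conv_of_real[where 'a = complex])
  have "A $ i $ j = spectral e d $ i $ j" for i j
  proof -
    have "A $ i $ j = (A ** spectral e (\<lambda>_. 1)) $ i $ j" by (simp add: spectral_one e)
    also have "\<dots> = (\<Sum>l\<in>UNIV. \<Sum>k\<in>UNIV. A $ i $ k * e l $ k * cnj (e l $ j))"
      by (simp add: matrix_matrix_mult_def spectral_entry sum_distrib_left mult.assoc) (rule sum.swap)
    finally show ?thesis by (simp add: eq spectral_entry flip: sum_distrib_right)
  qed
  then have "A = spectral e d" by (simp add: vec_eq_iff)
  with e show ?thesis by (rule that)
qed

lemma cinner_spectral_basis:
  assumes "orthonormal_basis e"
  shows "cinner (e j) (spectral e d *v e j) = of_real (d j)"
proof -
  have "(\<Sum>k\<in>UNIV. d k * (cmod (cinner (e k) (e j)))\<^sup>2) = (\<Sum>k\<in>UNIV. if k = j then d k else 0)"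
    using assms by (intro sum.cong) (auto simp: orthonormal_basis_def)
  then show ?thesis by (simp add: cinner_spectral)
qed

lemma state_spectral:
  assumes "state R"
  obtains e d where "orthonormal_basis e" "prob_distribution d" "R = spectral e d"
proof -
  obtain e d where e: "orthonormal_basis e" and R: "R = spectral e d"
    using hermitian_spectral assms by (auto simp: state_def positive_op_def)
  have "d j \<ge> 0" for j
  proof -
    have "cinner (e j) (R *v e j) = of_real (d j)" by (simp add: R cinner_spectral_basis e)
    moreover have "cinner (e j) (R *v e j) \<in> \<real>\<^sub>\<ge>\<^sub>0"
      using assms by (simp add: state_def positive_op_def)
    ultimately show ?thesis by simp
  qed
  moreover have "sum d UNIV = 1"
    using assms trace_spectral[OF e, of d] unfolding state_def R by (metis of_real_eq_1_iff)
  ultimately have "prob_distribution d" by (simp add: prob_distribution_def)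
  then show ?thesis using that e R by blast
qed

section \<open>Entropy and trace norm in an eigenbasis\<close>

lemma trace_norm_spectral:
  assumes "orthonormal_basis e"
  shows "trace_norm (spectral e d) = (\<Sum>j\<in>UNIV. \<bar>d j\<bar>)"
  by (simp add: trace_norm_def adjoint_mat_spectral spectral_mult fun_op_spectral trace_spectral assms)

text \<open>Discarding off-diagonal entries contracts the trace norm: triangle inequality for the
  averages of eigenvalues, then \<open>parseval\<close> in the other index.\<close>

lemma sum_abs_diag_le_trace_norm:
  assumes "adjoint_mat A = A" and b: "orthonormal_basis b"
  shows "(\<Sum>j\<in>UNIV. \<bar>Re (cinner (b j) (A *v b j))\<bar>) \<le> trace_norm A"
proof -
  obtain e d where e: "orthonormal_basis e" and A: "A = spectral e d"
    using hermitian_spectral assms(1) by blast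
  have w: "(cmod (cinner (e i) (b j)))\<^sup>2 = (cmod (cinner (b j) (e i)))\<^sup>2" for i j
    by (metis cnj_cinner complex_mod_cnj)
  have "(\<Sum>j\<in>UNIV. \<bar>Re (cinner (b j) (A *v b j))\<bar>)
      \<le> (\<Sum>j\<in>UNIV. \<Sum>i\<in>UNIV. \<bar>d i\<bar> * (cmod (cinner (e i) (b j)))\<^sup>2)"
    unfolding A cinner_spectral Re_complex_of_real
    by (intro sum_mono order_trans[OF sum_abs]) (simp add: abs_mult)
  also have "\<dots> = (\<Sum>i\<in>UNIV. \<bar>d i\<bar> * (\<Sum>j\<in>UNIV. (cmod (cinner (b j) (e i)))\<^sup>2))"
    by (subst sum.swap) (simp add: sum_distrib_left w)
  also have "\<dots> = trace_norm A"
    using e by (simp add: parseval[OF b] A trace_norm_spectral orthonormal_basis_def)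
  finally show ?thesis .
qed

lemma trace_norm_minus_commute: "trace_norm (A - B) = trace_norm (B - A)"
proof -
  have "adjoint_mat (A - B) ** (A - B) = adjoint_mat (B - A) ** (B - A)"
    by (simp add: vec_eq_iff matrix_matrix_mult_def adjoint_mat_def algebra_simps)
  then show ?thesis by (simp add: trace_norm_def)
qed

lemma vn_entropy_spectral:
  assumes "orthonormal_basis e"
  shows "vn_entropy (spectral e d) = (\<Sum>j\<in>UNIV. ent (d j))"
  by (simp add: vn_entropy_def fun_op_spectral spectral_mult trace_spectral assms ent_def sum_negf)

text \<open>Concavity of \<open>ent\<close> is the log-sum inequality for \<open>x i * w i\<close>
  against \<open>w i\<close>.\<close>

lemma jensen_ent:
  assumes "finite I" and w: "\<And>i. i \<in> I \<Longrightarrow> 0 \<le> w i" "sum w I = 1" and x: "\<And>i. i \<in> I \<Longrightarrow> 0 \<le> x i"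
  shows "(\<Sum>i\<in>I. w i * ent (x i)) \<le> ent (\<Sum>i\<in>I. x i * w i)"
proof -
  define m where "m = (\<Sum>i\<in>I. x i * w i)"
  have m: "m \<ge> 0" unfolding m_def using assms by (intro sum_nonneg) auto
  have "w i * ent (x i) = x i * w i * log 2 (w i / (x i * w i))" if "i \<in> I" for i
    using x[OF that] by (cases "x i = 0 \<or> w i = 0") (auto simp: ent_def log_divide)
  then have "(\<Sum>i\<in>I. w i * ent (x i)) = (\<Sum>i\<in>I. x i * w i * log 2 (w i / (x i * w i)))"
    by (rule sum.cong[OF refl])
  also have "\<dots> \<le> m * log 2 (sum w I / m)"
    unfolding m_def using assms by (intro log_sum_inequality) auto
  also have "\<dots> = ent m" using w(2) m by (cases "m = 0") (auto simp: ent_def log_divide)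
  finally show ?thesis by (simp add: m_def)
qed

text \<open>Jensen for each diagonal entry; the weights sum to one over either index by
  \<open>parseval\<close>.\<close>

lemma sum_ent_le_sum_ent_diag:
  assumes e: "orthonormal_basis e" and b: "orthonormal_basis b" and d: "\<And>i. 0 \<le> d i"
  shows "(\<Sum>i\<in>UNIV. ent (d i)) \<le> (\<Sum>j\<in>UNIV. ent (Re (cinner (b j) (spectral e d *v b j))))"
proof -
  have w: "(cmod (cinner (e i) (b j)))\<^sup>2 = (cmod (cinner (b j) (e i)))\<^sup>2" for i j
    by (metis cnj_cinner complex_mod_cnj)
  have "(\<Sum>i\<in>UNIV. ent (d i)) = (\<Sum>i\<in>UNIV. \<Sum>j\<in>UNIV. (cmod (cinner (e i) (b j)))\<^sup>2 * ent (d i))"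
    using e by (simp add: w parseval[OF b] orthonormal_basis_def flip: sum_distrib_right)
  also have "\<dots> = (\<Sum>j\<in>UNIV. \<Sum>i\<in>UNIV. (cmod (cinner (e i) (b j)))\<^sup>2 * ent (d i))"
    by (rule sum.swap)
  also have "\<dots> \<le> (\<Sum>j\<in>UNIV. ent (\<Sum>i\<in>UNIV. d i * (cmod (cinner (e i) (b j)))\<^sup>2))"
    using b d by (intro sum_mono jensen_ent) (auto simp: parseval[OF e] orthonormal_basis_def)
  finally show ?thesis by (simp add: cinner_spectral)
qed

section \<open>Classical-quantum states\<close>

text \<open>The basis on the first factor may depend on the label \<open>k\<close>, so that blocks
  which do not commute are still diagonalized by one basis of the whole space.\<close>

definition product_basis :: "('b \<Rightarrow> 'a \<Rightarrow> complex^'a) \<Rightarrow> ('b \<Rightarrow> complex^'b)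
    \<Rightarrow> 'a::finite \<times> 'b::finite \<Rightarrow> complex^('a \<times> 'b)" where
  "product_basis e ket = (\<lambda>(j, k). \<chi> i. e k j $ fst i * ket k $ snd i)"

lemma sum_UNIV_prod: "(\<Sum>i\<in>UNIV. f i) = (\<Sum>j\<in>UNIV. \<Sum>k\<in>UNIV. f (j, k))"
  for f :: "'a::finite \<times> 'b::finite \<Rightarrow> 'c::comm_monoid_add"
  unfolding UNIV_Times_UNIV[symmetric] by (rule sum.cartesian_product')

lemma cinner_product_basis:
  "cinner (product_basis e ket (j, k)) (product_basis e' ket (j', k'))
    = cinner (e k j) (e' k' j') * cinner (ket k) (ket k')"
  by (simp add: cinner_def product_basis_def sum_UNIV_prod sum_product mult_ac) (rule sum.swap)

text \<open>For different labels the \<open>ket\<close> factor vanishes; for equal labels both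
  vectors come from the same \<open>e k\<close>.\<close>

lemma orthonormal_product_basis:
  assumes "orthonormal_basis ket" "\<And>k. orthonormal_basis (e k)"
  shows "orthonormal_basis (product_basis e ket)"
  using assms by (auto simp: orthonormal_basis_def cinner_product_basis)

lemma cq_state_spectral:
  "(\<Sum>k\<in>UNIV. p k *\<^sub>R (spectral (e k) (r k) \<otimes>\<^sub>o\<^sub>p ket_bra (ket k) (ket k)))
    = spectral (product_basis e ket) (\<lambda>(j, k). p k * r k j)" (is "?L = ?R")
proof -
  have "?L $ i $ j = ?R $ i $ j" for i j
  proof -
    have "?L $ i $ j = (\<Sum>k\<in>UNIV. \<Sum>l\<in>UNIV. of_real (p k) * (of_real (r k l) * e k l $ fst i
        * cnj (e k l $ fst j) * (ket k $ snd i * cnj (ket k $ snd j))))"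
      by (simp add: tensor_op_def spectral_entry ket_bra_def)
        (simp add: scaleR_conv_of_real sum_distrib_left sum_distrib_right)
    also have "\<dots> = ?R $ i $ j"
      unfolding spectral_entry sum_UNIV_prod
      by (subst sum.swap) (simp add: product_basis_def mult_ac)
    finally show ?thesis .
  qed
  then show ?thesis by (simp add: vec_eq_iff)
qed

lemma partial_trace_fst_spectral_product_basis:
  assumes e: "\<And>k. orthonormal_basis (e k)"
  shows "partial_trace_fst (spectral (product_basis e ket) d) = spectral ket (\<lambda>k. \<Sum>j\<in>UNIV. d (j, k))"
    (is "?L = ?R")
proof -
  have "?L $ i $ i' = ?R $ i $ i'" for i i'
  proof -
    have "?L $ i $ i' = (\<Sum>a\<in>UNIV. \<Sum>j\<in>UNIV. \<Sum>k\<in>UNIV.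
        of_real (d (j, k)) * (cnj (e k j $ a) * e k j $ a) * (ket k $ i * cnj (ket k $ i')))"
      by (simp add: partial_trace_fst_def spectral_entry sum_UNIV_prod product_basis_def mult_ac)
    also have "\<dots> = (\<Sum>j\<in>UNIV. \<Sum>k\<in>UNIV. \<Sum>a\<in>UNIV.
        of_real (d (j, k)) * (cnj (e k j $ a) * e k j $ a) * (ket k $ i * cnj (ket k $ i')))"
      by (subst sum.swap, intro sum.cong refl, rule sum.swap)
    also have "\<dots> = (\<Sum>j\<in>UNIV. \<Sum>k\<in>UNIV.
        of_real (d (j, k)) * cinner (e k j) (e k j) * (ket k $ i * cnj (ket k $ i')))"
      by (simp add: cinner_def sum_distrib_left sum_distrib_right)
    also have "\<dots> = (\<Sum>k\<in>UNIV. \<Sum>j\<in>UNIV. of_real (d (j, k)) * (ket k $ i * cnj (ket k $ i')))"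
      using e by (subst sum.swap) (simp add: orthonormal_basis_def)
    finally show ?thesis by (simp add: spectral_entry sum_distrib_right sum_distrib_left mult_ac)
  qed
  then show ?thesis by (simp add: vec_eq_iff)
qed

text \<open>The right side is the functional \<open>F\<close> of
  \<open>classical_cond_ent_continuity\<close> at the eigenvalues \<open>d\<close>.\<close>

lemma cond_entropy_spectral_product_basis:
  assumes "orthonormal_basis ket" "\<And>k. orthonormal_basis (e k)"
  shows "cond_entropy (spectral (product_basis e ket) d)
    = (\<Sum>i\<in>UNIV. ent (d i)) - (\<Sum>k\<in>UNIV. ent (\<Sum>j\<in>UNIV. d (j, k)))"
  using assms
  by (simp add: cond_entropy_def vn_entropy_spectral orthonormal_product_basis
      partial_trace_fst_spectral_product_basis)

text \<open>The two bases share \<open>ket\<close>, so the diagonal entries with label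
  \<open>k\<close> sum to the trace of block \<open>k\<close>, which does not depend on the basis
  \<open>f k\<close> or \<open>e k\<close>.\<close>

lemma marginal_diag_product_basis:
  assumes ket: "orthonormal_basis ket"
    and e: "\<And>k. orthonormal_basis (e k)" and f: "\<And>k. orthonormal_basis (f k)"
  shows "(\<Sum>j\<in>UNIV. Re (cinner (product_basis f ket (j, k))
      (spectral (product_basis e ket) d *v product_basis f ket (j, k)))) = (\<Sum>j\<in>UNIV. d (j, k))"
proof -
  have w: "(cmod (cinner (e k i) (f k j)))\<^sup>2 = (cmod (cinner (f k j) (e k i)))\<^sup>2" for i j
    by (metis cnj_cinner complex_mod_cnj)
  have c: "(\<Sum>l\<in>UNIV. d (i, l) * (cmod (cinner (e l i) (f k j) * cinner (ket l) (ket k)))\<^sup>2)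
      = d (i, k) * (cmod (cinner (e k i) (f k j)))\<^sup>2" for i j
    using ket by (subst sum.mono_neutral_right[of _ "{k}"]) (auto simp: orthonormal_basis_def)
  have "(\<Sum>j\<in>UNIV. Re (cinner (product_basis f ket (j, k))
      (spectral (product_basis e ket) d *v product_basis f ket (j, k))))
      = (\<Sum>j\<in>UNIV. \<Sum>i\<in>UNIV. d (i, k) * (cmod (cinner (e k i) (f k j)))\<^sup>2)"
    by (simp add: cinner_spectral sum_UNIV_prod cinner_product_basis c del: of_real_sum)
  also have "\<dots> = (\<Sum>i\<in>UNIV. d (i, k) * (\<Sum>j\<in>UNIV. (cmod (cinner (f k j) (e k i)))\<^sup>2))"
    by (subst sum.swap) (simp add: sum_distrib_left w)
  also have "\<dots> = (\<Sum>i\<in>UNIV. d (i, k))"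
    using e by (simp add: parseval[OF f] orthonormal_basis_def)
  finally show ?thesis .
qed

section \<open>From states to classical distributions\<close>

lemma matrix_vector_diff_rdistrib: "(A - B) *v v = A *v v - B *v v" for A B :: "complex^'n^'m"
  by (simp add: vec_eq_iff matrix_vector_mult_def algebra_simps sum_subtractf)

lemma cond_entropy_diff_le:
  fixes e f :: "'b::finite \<Rightarrow> 'a::finite \<Rightarrow> complex^'a"
  assumes ket: "orthonormal_basis ket"
    and e: "\<And>k. orthonormal_basis (e k)" and f: "\<And>k. orthonormal_basis (f k)"
    and c: "\<And>i. 0 \<le> c i" "sum c UNIV = 1" and d: "\<And>i. 0 \<le> d i" "sum d UNIV = 1"
    and \<epsilon>: "trace_norm (spectral (product_basis e ket) c - spectral (product_basis f ket) d) \<le> \<epsilon>"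
  shows "cond_entropy (spectral (product_basis e ket) c) - cond_entropy (spectral (product_basis f ket) d)
    \<le> eta (2 * \<epsilon>) + 3 * \<epsilon> * log 2 (real CARD('a))"
proof -
  let ?b = "product_basis f ket" and ?R = "spectral (product_basis e ket) c"
    and ?S = "spectral (product_basis f ket) d"
  have b: "orthonormal_basis ?b" and b': "orthonormal_basis (product_basis e ket)"
    using ket e f by (auto intro: orthonormal_product_basis)
  \<comment> \<open>The classical stand-in for the first state: its diagonal in the eigenbasis of
    the second, where the second state has diagonal \<open>d\<close>.\<close>
  define x where "x i = Re (cinner (?b i) (?R *v ?b i))" for i
  have marg: "(\<Sum>j\<in>UNIV. x (j, k)) = (\<Sum>j\<in>UNIV. c (j, k))" for k
    unfolding x_def by (rule marginal_diag_product_basis[OF ket e f])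
  have "sum x UNIV = (\<Sum>k\<in>UNIV. \<Sum>j\<in>UNIV. x (j, k))"
    unfolding sum_UNIV_prod by (rule sum.swap)
  also have "\<dots> = (\<Sum>j\<in>UNIV. \<Sum>k\<in>UNIV. c (j, k))"
    unfolding marg by (rule sum.swap)
  also have "\<dots> = 1" using c(2) by (simp add: sum_UNIV_prod)
  finally have x1: "sum x UNIV = 1" .
  have x0: "0 \<le> x i" for i
    unfolding x_def cinner_spectral Re_complex_of_real using c by (intro sum_nonneg) auto
  have diag: "Re (cinner (?b i) (?S *v ?b i)) = d i" for i
    by (simp add: cinner_spectral_basis b)
  have "adjoint_mat (?R - ?S) = adjoint_mat ?R - adjoint_mat ?S"
    by (simp add: vec_eq_iff adjoint_mat_def)
  then have "adjoint_mat (?R - ?S) = ?R - ?S" by (simp add: adjoint_mat_spectral)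
  from sum_abs_diag_le_trace_norm[OF this b] \<epsilon>
  have "(\<Sum>i\<in>UNIV. \<bar>x i - d i\<bar>) \<le> \<epsilon>"
    by (simp add: matrix_vector_diff_rdistrib cinner_diff_right diag flip: x_def)
  from classical_cond_ent_continuity[OF x0 x1 d this]
  have "(\<Sum>i\<in>UNIV. ent (x i)) - (\<Sum>k\<in>UNIV. ent (\<Sum>j\<in>UNIV. c (j, k)))
      - cond_entropy ?S \<le> eta (2 * \<epsilon>) + 3 * \<epsilon> * log 2 (real CARD('a))"
    by (simp add: marg cond_entropy_spectral_product_basis[OF ket f])
  \<comment> \<open>Passing from \<open>c\<close> to \<open>x\<close> can only raise the joint
    entropy, and \<open>marg\<close> keeps the subtracted marginal entropy the same.\<close>
  moreover have "(\<Sum>i\<in>UNIV. ent (c i)) \<le> (\<Sum>i\<in>UNIV. ent (x i))"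
    unfolding x_def by (rule sum_ent_le_sum_ent_diag[OF b' b c(1)])
  ultimately show ?thesis
    by (simp add: cond_entropy_spectral_product_basis[OF ket e])
qed

lemma cq_state_diagonalization:
  fixes \<rho> :: "'b::finite \<Rightarrow> complex^'a::finite^'a"
  assumes p: "prob_distribution p" and "\<And>k. state (\<rho> k)"
  obtains e c where "\<And>k. orthonormal_basis (e k)" "\<And>i. 0 \<le> c i" "sum c UNIV = 1"
    "(\<Sum>k\<in>UNIV. p k *\<^sub>R (\<rho> k \<otimes>\<^sub>o\<^sub>p ket_bra (ket k) (ket k))) = spectral (product_basis e ket) c"
proof -
  have "\<forall>k. \<exists>e r. orthonormal_basis e \<and> prob_distribution r \<and> \<rho> k = spectral e r"
    using state_spectral assms(2) by metis
  then obtain e r where e: "\<And>k. orthonormal_basis (e k)" and r: "\<And>k. prob_distribution (r k)"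
    and \<rho>: "\<And>k. \<rho> k = spectral (e k) (r k)" by metis
  define c where "c = (\<lambda>(j, k). p k * r k j)"
  have "0 \<le> c i" for i
    using p r by (auto simp: c_def prob_distribution_def split: prod.split)
  moreover have "sum c UNIV = 1"
    unfolding sum_UNIV_prod using p r
    by (subst sum.swap) (simp add: c_def prob_distribution_def flip: sum_distrib_left)
  moreover have "(\<Sum>k\<in>UNIV. p k *\<^sub>R (\<rho> k \<otimes>\<^sub>o\<^sub>p ket_bra (ket k) (ket k))) = spectral (product_basis e ket) c"
    unfolding \<rho> c_def by (rule cq_state_spectral)
  ultimately show ?thesis using that e by blast
qed

theorem mainTheorem9:
  fixes ket :: "'b::finite \<Rightarrow> complex^'b"
    and p q :: "'b \<Rightarrow> real"
    and \<rho> \<sigma> :: "'b \<Rightarrow> complex^'a::finite^'a"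
    and \<rho>AB \<sigma>AB :: "complex^('a \<times> 'b)^('a \<times> 'b)"
    and \<epsilon> :: real
  assumes "orthonormal_basis ket"
    and "prob_distribution p" and "prob_distribution q"
    and "\<And>k. state (\<rho> k)" and "\<And>k. state (\<sigma> k)"
    and "\<rho>AB = (\<Sum>k\<in>UNIV. p k *\<^sub>R (\<rho> k \<otimes>\<^sub>o\<^sub>p ket_bra (ket k) (ket k)))"
    and "\<sigma>AB = (\<Sum>k\<in>UNIV. q k *\<^sub>R (\<sigma> k \<otimes>\<^sub>o\<^sub>p ket_bra (ket k) (ket k)))"
    and "trace_norm (\<rho>AB - \<sigma>AB) \<le> \<epsilon>"
  shows "\<bar>cond_entropy \<rho>AB - cond_entropy \<sigma>AB\<bar>
    \<le> eta (2 * \<epsilon>) + 3 * \<epsilon> * log 2 (real CARD('a))"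
proof -
  obtain e c where e: "\<And>k. orthonormal_basis (e k)" and c: "\<And>i. 0 \<le> c i" "sum c UNIV = 1"
    and \<rho>AB: "\<rho>AB = spectral (product_basis e ket) c"
    using cq_state_diagonalization[where \<rho> = \<rho> and ket = ket, OF assms(2,4), folded assms(6)] by blast
  obtain f d where f: "\<And>k. orthonormal_basis (f k)" and d: "\<And>i. 0 \<le> d i" "sum d UNIV = 1"
    and \<sigma>AB: "\<sigma>AB = spectral (product_basis f ket) d"
    using cq_state_diagonalization[where \<rho> = \<sigma> and ket = ket, OF assms(3,5), folded assms(7)] by blast
  have "cond_entropy \<rho>AB - cond_entropy \<sigma>AB \<le> eta (2 * \<epsilon>) + 3 * \<epsilon> * log 2 (real CARD('a))"
    using assms(8) unfolding \<rho>AB \<sigma>AB by (rule cond_entropy_diff_le[OF assms(1) e f c d])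
  \<comment> \<open>With the roles exchanged, the diagonal of \<open>\<sigma>AB\<close> is taken in
    the eigenbasis of \<open>\<rho>AB\<close>.\<close>
  moreover have "cond_entropy \<sigma>AB - cond_entropy \<rho>AB \<le> eta (2 * \<epsilon>) + 3 * \<epsilon> * log 2 (real CARD('a))"
    using assms(8) unfolding trace_norm_minus_commute[of \<rho>AB \<sigma>AB] unfolding \<rho>AB \<sigma>AB
    by (rule cond_entropy_diff_le[OF assms(1) f e d c])
  ultimately show ?thesis by linarith
qed

end
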